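(* Let $G$ and $H$ be Polish groups. Then every Baire measurable polynomial $\phi\colon G\to H$ is continuous.
   Context: A map between topological spaces is Baire measurable if the inverse image of every open set has the Baire property (i.e. differs from an open set by a meagre set). View $G$ as a $G$-space under left multiplication. For a map $\phi\colon G\to H$ and $g\in G$, the directional differential $d_g\phi\colon G\to H$ is defined by $d_g\phi(x)=\phi(gx)^{-1}\phi(x)$; since it is again a map from $G$ to $H$, this can be iterated, with $d_fd_g\phi=d_f(d_g\phi)$. A map $\phi\colon G\to H$ between groups is called a polynomial (of potentially transfinite degree) if for every infinite sequence $g_0,g_1,g_2,\ldots\in G$ there is a $k$ such that $d_{g_k}\cdots d_{g_0}\phi\equiv 1_H$, i.e. $d_{g_k}\cdots d_{g_0}\phi$ is the constant function with value the identity $1_H$ of $H$. (In particular, this includes polynomials of degree $\leqslant k$, i.e. maps $\phi$ with $d_{g_k}\cdots d_{g_0}\phi\equiv 1_H$ for all $g_0,\ldots,g_k\in G$.) *)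

theory Defs
  imports "HOL-Analysis.Analysis" "HOL-Algebra.Group"
begin

locale topological_group = group G for G (structure) and T :: "'a topology" +
  assumes topspace_eq_carrier: "topspace T = carrier G"
    and continuous_map_mult: "continuous_map (prod_topology T T) T (\<lambda>(x, y). x \<otimes> y)"
    and continuous_map_inv: "continuous_map T T (\<lambda>x. inv x)"

definition Polish_space :: "'a topology \<Rightarrow> bool" where
  "Polish_space X \<longleftrightarrow> completely_metrizable_space X \<and> separable_space X"

locale Polish_group = topological_group +
  assumes Polish_space: "Polish_space T"

text \<open>Sets are required to lie inside \<open>topspace X\<close>, because \<open>closure_of\<close> ignores all
  points outside of it.\<close>

definition nowhere_dense_in :: "'a topology \<Rightarrow> 'a set \<Rightarrow> bool" where
  "nowhere_dense_in X A \<longleftrightarrow> A \<subseteq> topspace X \<and> X interior_of (X closure_of A) = {}"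

definition meagre_in :: "'a topology \<Rightarrow> 'a set \<Rightarrow> bool" where
  "meagre_in X A \<longleftrightarrow> (\<exists>\<N>. countable \<N> \<and> (\<forall>N\<in>\<N>. nowhere_dense_in X N) \<and> A = \<Union>\<N>)"

definition Baire_property_in :: "'a topology \<Rightarrow> 'a set \<Rightarrow> bool" where
  "Baire_property_in X A \<longleftrightarrow> (\<exists>U. openin X U \<and> meagre_in X (sym_diff A U))"

definition Baire_measurable_map :: "'a topology \<Rightarrow> 'b topology \<Rightarrow> ('a \<Rightarrow> 'b) \<Rightarrow> bool" where
  "Baire_measurable_map X Y f \<longleftrightarrow>
     f \<in> topspace X \<rightarrow> topspace Y \<and>
     (\<forall>V. openin Y V \<longrightarrow> Baire_property_in X {x \<in> topspace X. f x \<in> V})"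

definition differential ::
    "('a, 'm) monoid_scheme \<Rightarrow> ('b, 'n) monoid_scheme \<Rightarrow> 'a \<Rightarrow> ('a \<Rightarrow> 'b) \<Rightarrow> 'a \<Rightarrow> 'b" where
  "differential G H g \<phi> = (\<lambda>x. inv\<^bsub>H\<^esub> (\<phi> (g \<otimes>\<^bsub>G\<^esub> x)) \<otimes>\<^bsub>H\<^esub> \<phi> x)"

text \<open>\<open>iterated_differential G H g n \<phi>\<close> takes the \<open>n\<close> differentials in the directions
  \<open>g 0, \<dots>, g (n - 1)\<close>, with \<open>g 0\<close> applied first.\<close>

primrec iterated_differential ::
    "('a, 'm) monoid_scheme \<Rightarrow> ('b, 'n) monoid_scheme \<Rightarrow> (nat \<Rightarrow> 'a) \<Rightarrow> nat \<Rightarrow> ('a \<Rightarrow> 'b) \<Rightarrow> 'a \<Rightarrow> 'b" where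
  "iterated_differential G H g 0 \<phi> = \<phi>"
| "iterated_differential G H g (Suc n) \<phi> = differential G H (g n) (iterated_differential G H g n \<phi>)"

definition polynomial_map ::
    "('a, 'm) monoid_scheme \<Rightarrow> ('b, 'n) monoid_scheme \<Rightarrow> ('a \<Rightarrow> 'b) \<Rightarrow> bool" where
  "polynomial_map G H \<phi> \<longleftrightarrow>
     \<phi> \<in> carrier G \<rightarrow> carrier H \<and>
     (\<forall>g :: nat \<Rightarrow> 'a. (\<forall>n. g n \<in> carrier G) \<longrightarrow>
        (\<exists>k. \<forall>x \<in> carrier G. iterated_differential G H g (Suc k) \<phi> x = \<one>\<^bsub>H\<^esub>))"

end

theory Submission
  imports Defs
begin

text \<open>
  A Baire measurable map into a second countable space is continuous off a meagre set; call this
  generic continuity.  It passes from \<open>\<phi>\<close> to every differential \<open>d\<^sub>g\<phi>\<close>, since translations preserve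
  meagre sets.  The heart of the matter is
  \<open>continuous_if_all_differentials_continuous\<close>: if \<open>\<phi>\<close> is generically continuous and \<open>d\<^sub>g\<phi>\<close> is
  continuous for every \<open>g\<close>, then \<open>\<phi>\<close> is continuous.  Indeed, suppose that \<open>x\<^sub>n\<close> converges to \<open>x\<close>.
  By the Baire category theorem some \<open>g\<close> moves the countably many points \<open>x, x\<^sub>0, x\<^sub>1, \<dots>\<close> off the
  exceptional meagre set, so that \<open>\<phi>(g x\<^sub>n)\<close> converges to \<open>\<phi>(g x)\<close>; multiplying by
  \<open>d\<^sub>g\<phi>(x\<^sub>n) \<rightarrow> d\<^sub>g\<phi>(x)\<close> gives \<open>\<phi>(x\<^sub>n) \<rightarrow> \<phi>(x)\<close>, because \<open>\<phi>(y) = \<phi>(g y) d\<^sub>g\<phi>(y)\<close>.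

  Read contrapositively, a discontinuous generically continuous map has a differential that is
  again discontinuous and generically continuous.  Starting from a discontinuous \<open>\<phi>\<close>, this
  produces an infinite sequence of directions along which no iterated differential is continuous.
  In particular none is constantly \<open>\<one>\<close>, so \<open>\<phi>\<close> is not a polynomial.
\<close>

section \<open>Meagre sets\<close>

lemma meagre_in_UN:
  assumes "countable I" and "\<And>i. i \<in> I \<Longrightarrow> meagre_in X (A i)"
  shows "meagre_in X (\<Union>i\<in>I. A i)"
proof -
  have "\<forall>i\<in>I. \<exists>\<N>. countable \<N> \<and> (\<forall>N\<in>\<N>. nowhere_dense_in X N) \<and> A i = \<Union>\<N>"
    using assms(2) unfolding meagre_in_def by blast
  then obtain \<N> where \<N>: "\<And>i. i \<in> I \<Longrightarrow> countable (\<N> i)"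
    "\<And>i N. \<lbrakk>i \<in> I; N \<in> \<N> i\<rbrakk> \<Longrightarrow> nowhere_dense_in X N" "\<And>i. i \<in> I \<Longrightarrow> A i = \<Union>(\<N> i)"
    by (metis bchoice)
  have "countable (\<Union>(\<N> ` I))"
    using assms(1) \<N>(1) by blast
  moreover have "\<forall>N\<in>\<Union>(\<N> ` I). nowhere_dense_in X N"
    using \<N>(2) by blast
  moreover have "(\<Union>i\<in>I. A i) = \<Union>(\<Union>(\<N> ` I))"
    using \<N>(3) by auto
  ultimately show ?thesis
    unfolding meagre_in_def by blast
qed

lemma meagre_in_Un:
  assumes "meagre_in X A" and "meagre_in X B"
  shows "meagre_in X (A \<union> B)"
  using meagre_in_UN[of "{A, B}" X "\<lambda>C. C"] assms by auto

lemma meagre_in_homeomorphic_image: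
  assumes f: "homeomorphic_map X Y f" and "meagre_in X A"
  shows "meagre_in Y (f ` A)"
proof -
  obtain \<N> where \<N>: "countable \<N>" "\<And>N. N \<in> \<N> \<Longrightarrow> nowhere_dense_in X N" "A = \<Union>\<N>"
    using assms(2) unfolding meagre_in_def by blast
  have "nowhere_dense_in Y (f ` N)" if "N \<in> \<N>" for N
  proof -
    have N: "N \<subseteq> topspace X" "X interior_of (X closure_of N) = {}"
      using \<N>(2)[OF that] unfolding nowhere_dense_in_def by auto
    have "Y interior_of (Y closure_of (f ` N)) = f ` (X interior_of (X closure_of N))"
      using homeomorphic_map_closure_of[OF f N(1)]
        homeomorphic_map_interior_of[OF f closure_of_subset_topspace] by metis
    moreover have "f ` N \<subseteq> topspace Y"
      using N(1) homeomorphic_imp_surjective_map[OF f] by blast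
    ultimately show ?thesis
      using N(2) unfolding nowhere_dense_in_def by simp
  qed
  then have "\<forall>N\<in>(`) f ` \<N>. nowhere_dense_in Y N"
    by blast
  moreover have "countable ((`) f ` \<N>)" "f ` A = \<Union>((`) f ` \<N>)"
    using \<N> by auto
  ultimately show ?thesis
    unfolding meagre_in_def by blast
qed

text \<open>The form of the Baire category theorem used below to find a point outside a meagre set.\<close>

lemma completely_metrizable_not_meagre_in_topspace:
  assumes "completely_metrizable_space X" and "topspace X \<noteq> {}"
  shows "\<not> meagre_in X (topspace X)"
proof
  assume "meagre_in X (topspace X)"
  then obtain \<N> where \<N>: "countable \<N>" "\<And>N. N \<in> \<N> \<Longrightarrow> nowhere_dense_in X N" "topspace X = \<Union>\<N>"
    unfolding meagre_in_def by (elim exE conjE) (rule that, auto dest: bspec)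
  have "X interior_of \<Union>((closure_of) X ` \<N>) = {}"
  proof (rule Baire_category_alt)
    show "countable ((closure_of) X ` \<N>)"
      using \<N>(1) by (rule countable_image)
    show "closedin X F \<and> X interior_of F = {}" if "F \<in> (closure_of) X ` \<N>" for F
      using that \<N>(2) unfolding nowhere_dense_in_def by (elim imageE) simp
  qed (use assms(1) in simp)
  moreover have "\<Union>((closure_of) X ` \<N>) = topspace X"
  proof (intro equalityI subsetI)
    fix x assume "x \<in> \<Union>((closure_of) X ` \<N>)"
    then show "x \<in> topspace X"
      using closure_of_subset_topspace[of X] by (elim UN_E) (rule subsetD)
  next
    fix x assume "x \<in> topspace X"
    then obtain N where N: "N \<in> \<N>" "x \<in> N"
      using \<N>(3) by blast
    then have "N \<subseteq> X closure_of N"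
      using \<N>(2) unfolding nowhere_dense_in_def by (intro closure_of_subset) simp
    with N show "x \<in> \<Union>((closure_of) X ` \<N>)" by (intro UN_I) (rule N(1), rule subsetD)
  qed
  ultimately have "X interior_of topspace X = {}"
    by (rule subst[rotated])
  then show False
    using assms(2) interior_of_topspace[of X] by simp
qed

section \<open>Metrizable spaces\<close>

text \<open>The balls with rational radius centred at a countable dense set form a base.\<close>

lemma metrizable_separable_imp_second_countable:
  assumes "metrizable_space X" and "separable_space X"
  shows "second_countable X"
proof -
  obtain M d where "Metric_space M d" and X: "X = Metric_space.mtopology M d"
    using assms(1) unfolding metrizable_space_def by blast
  interpret Metric_space M d by fact
  obtain D where D: "countable D" "D \<subseteq> M" "mtopology closure_of D = M"
    using assms(2) unfolding separable_space_def X by auto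
  define \<B> where "\<B> = (\<lambda>(c, r). mball c r) ` (D \<times> {r \<in> \<rat>. 0 < r})"
  have "countable \<B>"
    unfolding \<B>_def using D(1) countable_rat
    by (intro countable_image countable_SIGMA) (auto intro: countable_subset[of _ "\<rat>"])
  moreover have "\<forall>V\<in>\<B>. openin X V"
    unfolding \<B>_def X by auto
  moreover have "\<exists>V\<in>\<B>. x \<in> V \<and> V \<subseteq> U" if U: "openin X U" "x \<in> U" for U x
  proof -
    obtain r where r: "r > 0" "mball x r \<subseteq> U"
      using U unfolding X openin_mtopology by blast
    have x: "x \<in> M"
      using openin_subset[OF U(1)] U(2) unfolding X by auto
    obtain q where q: "q \<in> \<rat>" "0 < q" "q < r / 2"
      using Rats_dense_in_real[of 0 "r / 2"] r(1) by auto
    obtain c where c: "c \<in> D" "c \<in> mball x q"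
    proof -
      have "x \<in> mtopology closure_of D"
        using D(3) x by simp
      with q(2) show ?thesis
        using that unfolding metric_closure_of by blast
    qed
    have "x \<in> mball c q"
      using c by (simp add: commute)
    moreover have "mball c q \<subseteq> mball x r"
      using c q by (intro mball_subset) (auto simp: commute)
    ultimately show ?thesis
      using c(1) q r(2) unfolding \<B>_def by blast
  qed
  ultimately show ?thesis
    unfolding second_countable_def by (intro exI[of _ \<B>]) simp
qed

text \<open>In a metrizable space a set is closed as soon as it is closed under limits of sequences, and this
  is what the hypothesis gives for preimages of closed sets.  It is essential for the application
  that only countably many points are involved in each instance.\<close>

lemma metrizable_sequentially_continuous_imp_continuous_map:
  assumes "metrizable_space X"
    and lim: "\<And>\<sigma> x. limitin X \<sigma> x sequentially \<Longrightarrow> range \<sigma> \<subseteq> topspace X \<Longrightarrow>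
      limitin Y (f \<circ> \<sigma>) (f x) sequentially"
  shows "continuous_map X Y f"
proof -
  obtain M d where "Metric_space M d" and X: "X = Metric_space.mtopology M d"
    using assms(1) unfolding metrizable_space_def by blast
  interpret Metric_space M d by fact
  have fim: "f x \<in> topspace Y" if "x \<in> topspace X" for x
    using lim[of "\<lambda>_. x" x] that by (auto simp: limitin_topspace limitin_const_iff)
  have "closedin X {x \<in> topspace X. f x \<in> C}" if C: "closedin Y C" for C
    unfolding X metric_closedin_iff_sequentially_closed
  proof (intro conjI allI impI; (elim conjE)?)
    fix \<sigma> l
    assume \<sigma>: "range \<sigma> \<subseteq> {x \<in> topspace mtopology. f x \<in> C}"
      and l: "limitin mtopology \<sigma> l sequentially"
    have "limitin Y (f \<circ> \<sigma>) (f l) sequentially"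
      using lim[of \<sigma> l] \<sigma> l unfolding X by blast
    then have "f l \<in> C"
      using \<sigma> by (intro limitin_closedin[OF _ C]) (auto simp: subset_iff intro!: always_eventually)
    then show "l \<in> {x \<in> topspace mtopology. f x \<in> C}"
      using limitin_topspace[OF l] by blast
  qed auto
  then show ?thesis
    unfolding continuous_map_closedin using fim by blast
qed

section \<open>Generic continuity\<close>

text \<open>Preferred here to Baire measurability because it passes to products and translates of maps
  directly, by enlarging the exceptional set, without returning to open sets of the target.\<close>

definition generically_continuous_map :: "'a topology \<Rightarrow> 'b topology \<Rightarrow> ('a \<Rightarrow> 'b) \<Rightarrow> bool" where
  "generically_continuous_map X Y f \<longleftrightarrow>
     (\<exists>M. meagre_in X M \<and> continuous_map (subtopology X (topspace X - M)) Y f)"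

text \<open>For each \<open>V\<close> in a countable base of \<open>Y\<close>, the preimage of \<open>V\<close> agrees with an open set off a meagre
  set.  Removing these countably many meagre sets simultaneously makes all the preimages
  relatively open.\<close>

lemma Baire_measurable_imp_generically_continuous:
  assumes f: "Baire_measurable_map X Y f" and "second_countable Y"
  shows "generically_continuous_map X Y f"
proof -
  obtain \<B> where \<B>: "countable \<B>" "\<And>V. V \<in> \<B> \<Longrightarrow> openin Y V"
    "\<And>U y. \<lbrakk>openin Y U; y \<in> U\<rbrakk> \<Longrightarrow> \<exists>V\<in>\<B>. y \<in> V \<and> V \<subseteq> U"
    using assms(2) unfolding second_countable_def by metis
  have "\<forall>V\<in>\<B>. \<exists>U. openin X U \<and> meagre_in X (sym_diff {x \<in> topspace X. f x \<in> V} U)"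
    using f \<B>(2) unfolding Baire_measurable_map_def Baire_property_in_def by blast
  from bchoice[OF this] obtain U where U: "\<And>V. V \<in> \<B> \<Longrightarrow> openin X (U V)"
    "\<And>V. V \<in> \<B> \<Longrightarrow> meagre_in X (sym_diff {x \<in> topspace X. f x \<in> V} (U V))"
    by auto
  define M where "M = (\<Union>V\<in>\<B>. sym_diff {x \<in> topspace X. f x \<in> V} (U V))"
  have "meagre_in X M"
    unfolding M_def using \<B>(1) U(2) by (intro meagre_in_UN)
  moreover have "continuous_map (subtopology X (topspace X - M)) Y f"
    unfolding continuous_map_def
  proof (intro conjI allI impI)
    show "f \<in> topspace (subtopology X (topspace X - M)) \<rightarrow> topspace Y"
      using f unfolding Baire_measurable_map_def by auto
    fix W assume W: "openin Y W"
    let ?W = "\<Union>V\<in>{V \<in> \<B>. V \<subseteq> W}. U V"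
    have "openin X ?W"
      using U(1) by blast
    moreover have "{x \<in> topspace (subtopology X (topspace X - M)). f x \<in> W} = ?W \<inter> (topspace X - M)"
      (is "?L = ?R")
    proof
      show "?L \<subseteq> ?R"
      proof
        fix x assume x: "x \<in> ?L"
        then obtain V where V: "V \<in> \<B>" "f x \<in> V" "V \<subseteq> W"
          using \<B>(3)[OF W, of "f x"] by auto
        have x': "x \<in> topspace X" "x \<notin> M"
          using x by auto
        with V(1,2) have "x \<in> U V"
          unfolding M_def by blast
        with V x' show "x \<in> ?R"
          by blast
      qed
      show "?R \<subseteq> ?L"
      proof
        fix x assume x: "x \<in> ?R"
        then obtain V where V: "V \<in> \<B>" "V \<subseteq> W" "x \<in> U V"
          by blast
        with x have "f x \<in> V"
          unfolding M_def by blast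
        with V(2) x show "x \<in> ?L"
          by auto
      qed
    qed
    ultimately show "openin (subtopology X (topspace X - M))
        {x \<in> topspace (subtopology X (topspace X - M)). f x \<in> W}"
      unfolding openin_subtopology by blast
  qed
  ultimately show ?thesis
    unfolding generically_continuous_map_def by blast
qed

section \<open>Translations in a topological group\<close>

context topological_group
begin

lemma homeomorphic_map_mult_left:
  assumes "a \<in> carrier G"
  shows "homeomorphic_map T T (\<lambda>x. a \<otimes> x)"
proof -
  have cont: "continuous_map T T (\<lambda>x. b \<otimes> x)" if "b \<in> carrier G" for b
    using continuous_map_compose[OF _ continuous_map_mult, of T "\<lambda>x. (b, x)"] that
    by (simp add: continuous_map_pairedI topspace_eq_carrier o_def)
  have "homeomorphic_maps T T (\<lambda>x. a \<otimes> x) (\<lambda>x. inv a \<otimes> x)"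
    using cont assms unfolding homeomorphic_maps_def
    by (auto simp: topspace_eq_carrier m_assoc[symmetric])
  then show ?thesis
    by (rule homeomorphic_maps_imp_map)
qed

lemma homeomorphic_map_mult_right:
  assumes "a \<in> carrier G"
  shows "homeomorphic_map T T (\<lambda>x. x \<otimes> a)"
proof -
  have cont: "continuous_map T T (\<lambda>x. x \<otimes> b)" if "b \<in> carrier G" for b
    using continuous_map_compose[OF _ continuous_map_mult, of T "\<lambda>x. (x, b)"] that
    by (simp add: continuous_map_pairedI topspace_eq_carrier o_def)
  have "homeomorphic_maps T T (\<lambda>x. x \<otimes> a) (\<lambda>x. x \<otimes> inv a)"
    using cont assms unfolding homeomorphic_maps_def
    by (auto simp: topspace_eq_carrier m_assoc)
  then show ?thesis
    by (rule homeomorphic_maps_imp_map)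
qed

lemma continuous_map_mult_fun:
  assumes "continuous_map X T f" and "continuous_map X T g"
  shows "continuous_map X T (\<lambda>x. f x \<otimes> g x)"
  using continuous_map_compose[OF continuous_map_pairedI[OF assms] continuous_map_mult]
  by (simp add: o_def)

lemma continuous_map_inv_fun:
  assumes "continuous_map X T f"
  shows "continuous_map X T (\<lambda>x. inv (f x))"
  using continuous_map_compose[OF assms continuous_map_inv] by (simp add: o_def)

lemma limitin_mult:
  assumes "limitin T f a F" and "limitin T g b F"
  shows "limitin T (\<lambda>x. f x \<otimes> g x) (a \<otimes> b) F"
  using continuous_map_limit[OF continuous_map_mult, of "\<lambda>x. (f x, g x)" "(a, b)" F] assms
  by (simp add: limitin_pairwise o_def)

lemma meagre_in_mult_left_vimage:
  assumes a: "a \<in> carrier G" and M: "meagre_in T M"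
  shows "meagre_in T {x \<in> carrier G. a \<otimes> x \<in> M}"
proof -
  have "M \<subseteq> carrier G"
    using M unfolding meagre_in_def nowhere_dense_in_def topspace_eq_carrier by blast
  then have "(\<lambda>x. inv a \<otimes> x) ` M = {x \<in> carrier G. a \<otimes> x \<in> M}"
    using a by (intro equalityI subsetI)
      (auto simp: m_assoc[symmetric] intro: rev_image_eqI[of "a \<otimes> _"])
  then show ?thesis
    using meagre_in_homeomorphic_image[OF homeomorphic_map_mult_left[of "inv a"] M] a by simp
qed

lemma meagre_in_mult_right_vimage:
  assumes a: "a \<in> carrier G" and M: "meagre_in T M"
  shows "meagre_in T {x \<in> carrier G. x \<otimes> a \<in> M}"
proof -
  have "M \<subseteq> carrier G"
    using M unfolding meagre_in_def nowhere_dense_in_def topspace_eq_carrier by blast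
  then have "(\<lambda>x. x \<otimes> inv a) ` M = {x \<in> carrier G. x \<otimes> a \<in> M}"
    using a by (intro equalityI subsetI)
      (auto simp: m_assoc intro: rev_image_eqI[of "_ \<otimes> a"])
  then show ?thesis
    using meagre_in_homeomorphic_image[OF homeomorphic_map_mult_right[of "inv a"] M] a by simp
qed

end

text \<open>The bad \<open>g\<close> for a point \<open>a\<close> form the right translate of \<open>M\<close> by \<open>a\<inverse>\<close>, which is
  meagre; countably many such translates cannot cover the group.\<close>

lemma (in Polish_group) ex_translate_avoiding_meagre:
  assumes M: "meagre_in T M" and A: "countable A" "A \<subseteq> carrier G"
  shows "\<exists>g\<in>carrier G. \<forall>a\<in>A. g \<otimes> a \<notin> M"
proof (rule ccontr)
  assume "\<not> ?thesis"
  then have "carrier G = (\<Union>a\<in>A. {g \<in> carrier G. g \<otimes> a \<in> M})"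
    by blast
  moreover have "meagre_in T (\<Union>a\<in>A. {g \<in> carrier G. g \<otimes> a \<in> M})"
    using A by (intro meagre_in_UN meagre_in_mult_right_vimage M) auto
  moreover have "\<not> meagre_in T (carrier G)"
    using completely_metrizable_not_meagre_in_topspace[of T] Polish_space one_closed
    unfolding Polish_space_def topspace_eq_carrier by blast
  ultimately show False by simp
qed

section \<open>Differentials\<close>

lemma differential_closed:
  assumes "group G" "group H" "\<phi> \<in> carrier G \<rightarrow> carrier H" "g \<in> carrier G"
  shows "differential G H g \<phi> \<in> carrier G \<rightarrow> carrier H"
proof -
  interpret G: group G by fact
  interpret H: group H by fact
  show ?thesis
    unfolding differential_def
    by (intro Pi_I H.m_closed H.inv_closed funcset_mem[OF assms(3)] G.m_closed assms(4))
qed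

text \<open>Both factors \<open>\<phi>(g x)\<inverse>\<close> and \<open>\<phi>(x)\<close> are continuous off the union of the exceptional set \<open>M\<close> with
  its translate \<open>g\<inverse>M\<close>.\<close>

lemma generically_continuous_differential:
  assumes "topological_group G S" and "topological_group H T"
    and \<phi>: "generically_continuous_map S T \<phi>" and g: "g \<in> carrier G"
  shows "generically_continuous_map S T (differential G H g \<phi>)"
proof -
  interpret G: topological_group G S by fact
  interpret H: topological_group H T by fact
  obtain M where M: "meagre_in S M" and cont: "continuous_map (subtopology S (topspace S - M)) T \<phi>"
    using \<phi> unfolding generically_continuous_map_def by blast
  define N where "N = M \<union> {x \<in> carrier G. g \<otimes>\<^bsub>G\<^esub> x \<in> M}"
  have N: "meagre_in S N"
    unfolding N_def using M G.meagre_in_mult_left_vimage[OF g M] by (rule meagre_in_Un)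
  have 1: "continuous_map (subtopology S (topspace S - N)) T \<phi>"
    by (rule continuous_map_from_subtopology_mono[OF cont]) (auto simp: N_def)
  have "continuous_map (subtopology S (topspace S - N)) (subtopology S (topspace S - M)) (\<lambda>x. g \<otimes>\<^bsub>G\<^esub> x)"
    using homeomorphic_imp_continuous_map[OF G.homeomorphic_map_mult_left[OF g]] g
    by (auto simp: continuous_map_in_subtopology N_def G.topspace_eq_carrier
        intro!: continuous_map_from_subtopology)
  from continuous_map_compose[OF this cont]
  have 2: "continuous_map (subtopology S (topspace S - N)) T (\<lambda>x. \<phi> (g \<otimes>\<^bsub>G\<^esub> x))"
    by (simp add: o_def)
  have "continuous_map (subtopology S (topspace S - N)) T (differential G H g \<phi>)"
    unfolding differential_def
    by (intro H.continuous_map_mult_fun H.continuous_map_inv_fun 1 2)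
  with N show ?thesis
    unfolding generically_continuous_map_def by blast
qed

text \<open>The direction \<open>g\<close> may depend on the convergent sequence, because the differential is assumed
  continuous in every direction.  It is chosen so that the translated sequence and its limit lie
  where \<open>\<phi>\<close> is known to be continuous; the differential carries convergence back.\<close>

lemma continuous_if_all_differentials_continuous:
  assumes "Polish_group G S" and "topological_group H T"
    and closed: "\<phi> \<in> carrier G \<rightarrow> carrier H"
    and \<phi>: "generically_continuous_map S T \<phi>"
    and diff: "\<And>g. g \<in> carrier G \<Longrightarrow> continuous_map S T (differential G H g \<phi>)"
  shows "continuous_map S T \<phi>"
proof (rule metrizable_sequentially_continuous_imp_continuous_map)
  interpret G: Polish_group G S by fact
  interpret H: topological_group H T by fact
  show "metrizable_space S"
    using G.Polish_space completely_metrizable_imp_metrizable_space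
    unfolding Polish_space_def by blast
  obtain M where M: "meagre_in S M" and cont: "continuous_map (subtopology S (topspace S - M)) T \<phi>"
    using \<phi> unfolding generically_continuous_map_def by blast
  fix \<sigma> x
  assume lim: "limitin S \<sigma> x sequentially" and "range \<sigma> \<subseteq> topspace S"
  then have mem: "x \<in> carrier G" "\<And>n. \<sigma> n \<in> carrier G"
    using limitin_topspace[OF lim] by (auto simp: G.topspace_eq_carrier)
  obtain g where g: "g \<in> carrier G" "g \<otimes>\<^bsub>G\<^esub> x \<notin> M" "\<And>n. g \<otimes>\<^bsub>G\<^esub> \<sigma> n \<notin> M"
    using G.ex_translate_avoiding_meagre[OF M, of "insert x (range \<sigma>)"] mem by auto
  have "limitin S (\<lambda>n. g \<otimes>\<^bsub>G\<^esub> \<sigma> n) (g \<otimes>\<^bsub>G\<^esub> x) sequentially"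
    using continuous_map_limit[OF homeomorphic_imp_continuous_map[OF
          G.homeomorphic_map_mult_left[OF g(1)]] lim]
    by (simp add: o_def)
  then have "limitin (subtopology S (topspace S - M)) (\<lambda>n. g \<otimes>\<^bsub>G\<^esub> \<sigma> n) (g \<otimes>\<^bsub>G\<^esub> x) sequentially"
    using g mem by (simp add: limitin_subtopology G.topspace_eq_carrier)
  from continuous_map_limit[OF cont this]
  have 1: "limitin T (\<lambda>n. \<phi> (g \<otimes>\<^bsub>G\<^esub> \<sigma> n)) (\<phi> (g \<otimes>\<^bsub>G\<^esub> x)) sequentially"
    by (simp add: o_def)
  have 2: "limitin T (\<lambda>n. differential G H g \<phi> (\<sigma> n)) (differential G H g \<phi> x) sequentially"
    using continuous_map_limit[OF diff[OF g(1)] lim] by (simp add: o_def)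
  have eq: "\<phi> (g \<otimes>\<^bsub>G\<^esub> y) \<otimes>\<^bsub>H\<^esub> differential G H g \<phi> y = \<phi> y" if "y \<in> carrier G" for y
  proof -
    have "\<phi> y \<in> carrier H" "\<phi> (g \<otimes>\<^bsub>G\<^esub> y) \<in> carrier H"
      using closed that g(1) by auto
    then show ?thesis
      by (simp add: differential_def H.m_assoc[symmetric])
  qed
  show "limitin T (\<phi> \<circ> \<sigma>) (\<phi> x) sequentially"
    using H.limitin_mult[OF 1 2] by (simp add: eq mem o_def)
qed

section \<open>Automatic continuity of polynomials\<close>

theorem corollary1p4:
  fixes G :: "('a, 'm) monoid_scheme" and S :: "'a topology"
    and H :: "('b, 'n) monoid_scheme" and T :: "'b topology"
    and \<phi> :: "'a \<Rightarrow> 'b"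
  assumes "Polish_group G S"
    and "Polish_group H T"
    and "polynomial_map G H \<phi>"
    and "Baire_measurable_map S T \<phi>"
  shows "continuous_map S T \<phi>"
proof (rule ccontr)
  assume discont: "\<not> continuous_map S T \<phi>"
  interpret G: Polish_group G S by fact
  interpret H: Polish_group H T by fact
  define P where "P \<psi> \<longleftrightarrow> \<psi> \<in> carrier G \<rightarrow> carrier H \<and> generically_continuous_map S T \<psi> \<and>
      \<not> continuous_map S T \<psi>" for \<psi>
  have "second_countable T"
    using H.Polish_space completely_metrizable_imp_metrizable_space
      metrizable_separable_imp_second_countable
    unfolding Polish_space_def by blast
  moreover have "\<phi> \<in> carrier G \<rightarrow> carrier H"
    using assms(3) unfolding polynomial_map_def by (rule conjunct1)
  ultimately have P0: "P \<phi>"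
    unfolding P_def using assms(4) discont Baire_measurable_imp_generically_continuous by blast
  have step: "\<exists>g\<in>carrier G. P (differential G H g \<psi>)" if "P \<psi>" for \<psi>
  proof -
    have \<psi>: "\<psi> \<in> carrier G \<rightarrow> carrier H" "generically_continuous_map S T \<psi>"
      "\<not> continuous_map S T \<psi>"
      using that unfolding P_def by auto
    then obtain g where "g \<in> carrier G" "\<not> continuous_map S T (differential G H g \<psi>)"
      using continuous_if_all_differentials_continuous[OF G.Polish_group_axioms
          H.topological_group_axioms] by blast
    with \<psi> show ?thesis
      unfolding P_def
      using differential_closed[OF G.group_axioms H.group_axioms]
        generically_continuous_differential[OF G.topological_group_axioms H.topological_group_axioms]
      by blast
  qed
  then obtain d where d: "\<And>\<psi>. P \<psi> \<Longrightarrow> d \<psi> \<in> carrier G \<and> P (differential G H (d \<psi>) \<psi>)"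
    by metis
  \<comment> \<open>The next direction is determined by the current iterated differential, so the sequence of
      differentials is built first and the directions are read off from it.\<close>
  define \<Psi> where "\<Psi> = rec_nat \<phi> (\<lambda>_ \<psi>. differential G H (d \<psi>) \<psi>)"
  define g where "g n = d (\<Psi> n)" for n
  have \<Psi>: "iterated_differential G H g n \<phi> = \<Psi> n" for n
    by (induction n) (simp_all add: \<Psi>_def g_def)
  have P: "P (\<Psi> n)" for n
    by (induction n) (use P0 d in \<open>simp_all add: \<Psi>_def\<close>)
  have "\<forall>n. g n \<in> carrier G"
    using d P unfolding g_def by blast
  then obtain k where k: "\<And>x. x \<in> carrier G \<Longrightarrow> \<Psi> (Suc k) x = \<one>\<^bsub>H\<^esub>"
    using assms(3) \<Psi> unfolding polynomial_map_def by metis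
  have "continuous_map S T (\<Psi> (Suc k))"
    by (rule continuous_map_eq[of S T "\<lambda>_. \<one>\<^bsub>H\<^esub>"])
      (simp_all add: k G.topspace_eq_carrier H.topspace_eq_carrier)
  with P[of "Suc k"] show False
    unfolding P_def by blast
qed

end
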